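(* $\mathsf{DNR}_3<^{<\omega}_1\mathsf{DNR}_2$, and $\mathsf{DNR}_3<^1_\omega\mathsf{DNR}_2$.
   Context: $\mathsf{DNR}_k$ is the set of all $k$-valued diagonally noncomputable functions, i.e. all total $f:\mathbb N\to\mathbb N$ with $f(n)<k$ for every $n$ and $f(e)\neq\Phi_e(e)$ whenever $\Phi_e(e)$ converges (here $\Phi_e(e)$ is the value of the $e$-th partial computable function on $\mathbb N$ at $e$). Let also $\{\Phi_e\}_{e\in\mathbb N}$ denote an effective enumeration of all partial computable functions $\Phi_e:\subseteq\mathbb N^{\mathbb N}\to\mathbb N^{\mathbb N}$. A learner is a total computable function $\Psi:\mathbb N^{<\mathbb N}\to\mathbb N$. A partial function $\Gamma:\subseteq\mathbb N^{\mathbb N}\to\mathbb N^{\mathbb N}$ is $(<\omega,1)$-computable if there is $b\in\mathbb N$ such that for every $g\in\mathrm{dom}(\Gamma)$, $\Gamma(g)=\Phi_e(g)$ for some $e<b$. It is $(1,\omega)$-computable if there is a learner $\Psi$ such that for every $g\in\mathrm{dom}(\Gamma)$ the limit $\lim_n\Psi(g\upharpoonright n)$ exists and $\Phi_{\lim_n\Psi(g\upharpoonright n)}(g)=\Gamma(g)$. For $A,B\subseteq\mathbb N^{\mathbb N}$, $A\le^\alpha_\beta B$ means there is an $(\alpha,\beta)$-computable $\Gamma$ with $B\subseteq\mathrm{dom}(\Gamma)$ and $\Gamma(g)\in A$ for every $g\in B$; $A<^\alpha_\beta B$ means $A\le^\alpha_\beta B$ and $B\not\le^\alpha_\beta A$.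 *)

theory Defs
  imports Complex_Main "HOL-Library.Nat_Bijection"
begin

section \<open>Oracle computability\<close>

type_synonym baire = "nat \<Rightarrow> nat"

text \<open>
  Programs for the unary functions that are partial recursive in an oracle. Several arguments are
  packed into one number by the pairing bijection \<^const>\<open>prod_encode\<close>, so that projections
  and composition of functions of several variables reduce to \<open>Fst\<close>, \<open>Snd\<close>, \<open>Tuple\<close> and \<open>Comp\<close>.
\<close>

datatype prog =
    Zero | Succ | Fst | Snd | Oracle
  | Tuple prog prog | Comp prog prog | PrimRec prog prog | Mu prog

inductive eval :: "baire \<Rightarrow> prog \<Rightarrow> nat \<Rightarrow> nat \<Rightarrow> bool" for g :: baire where
  Zero: "eval g Zero x 0"
| Succ: "eval g Succ x (Suc x)"
| Fst: "eval g Fst x (fst (prod_decode x))"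
| Snd: "eval g Snd x (snd (prod_decode x))"
| Oracle: "eval g Oracle x (g x)"
| Tuple: "eval g p x y \<Longrightarrow> eval g q x z \<Longrightarrow> eval g (Tuple p q) x (prod_encode (y, z))"
| Comp: "eval g q x y \<Longrightarrow> eval g p y z \<Longrightarrow> eval g (Comp p q) x z"
| PrimRec_0: "eval g p x y \<Longrightarrow> eval g (PrimRec p q) (prod_encode (x, 0)) y"
| PrimRec_Suc: "eval g (PrimRec p q) (prod_encode (x, n)) y \<Longrightarrow>
    eval g q (prod_encode (x, prod_encode (n, y))) z \<Longrightarrow>
    eval g (PrimRec p q) (prod_encode (x, Suc n)) z"
| Mu: "eval g p (prod_encode (x, n)) 0 \<Longrightarrow>
    (\<And>m. m < n \<Longrightarrow> \<exists>y. 0 < y \<and> eval g p (prod_encode (x, m)) y) \<Longrightarrow>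
    eval g (Mu p) x n"

lemma eval_deterministic: "eval g p x y \<Longrightarrow> eval g p x z \<Longrightarrow> y = z"
proof (induction arbitrary: z rule: eval.induct)
  case (PrimRec_0 p x y q)
  from PrimRec_0.prems show ?case by cases (auto intro: PrimRec_0.IH)
next
  case (PrimRec_Suc p q x n y v)
  from PrimRec_Suc.prems show ?case
    by cases (use PrimRec_Suc.IH in auto)
next
  case (Mu p x n)
  from Mu.prems show ?case
  proof cases
    case Mu': Mu
    show ?thesis
    proof (rule linorder_cases[of n z])
      assume "n < z"
      then obtain y where "0 < y" "eval g p (prod_encode (x, n)) y" using Mu'(2) by blast
      then show ?thesis using Mu.IH(1) by blast
    next
      assume "z < n"
      then show ?thesis using Mu.IH(2) Mu'(1) by blast
    qed
  qed
next
  case (Tuple p x y q z v)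
  from Tuple.prems show ?case by cases (use Tuple.IH in auto)
next
  case (Comp q x y p z v)
  from Comp.prems show ?case by cases (use Comp.IH in blast)
qed (erule eval.cases; simp)+

primrec goedel :: "prog \<Rightarrow> nat" where
  "goedel Zero = 0"
| "goedel Succ = 1"
| "goedel Fst = 2"
| "goedel Snd = 3"
| "goedel Oracle = 4"
| "goedel (Tuple p q) = 5 + 4 * prod_encode (goedel p, goedel q)"
| "goedel (Comp p q) = 6 + 4 * prod_encode (goedel p, goedel q)"
| "goedel (PrimRec p q) = 7 + 4 * prod_encode (goedel p, goedel q)"
| "goedel (Mu p) = 8 + 4 * goedel p"

lemma inj_goedel: "inj goedel"
proof (rule injI)
  have mod4: "(5 + 4 * k) mod 4 = 1" "(6 + 4 * k) mod 4 = 2" "(7 + 4 * k) mod 4 = 3"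
    "(8 + 4 * k) mod 4 = 0" for k :: nat
    by presburger+
  have neq: "5 + 4 * k \<noteq> 6 + 4 * l" "5 + 4 * k \<noteq> 7 + 4 * l" "5 + 4 * k \<noteq> 8 + 4 * l"
    "6 + 4 * k \<noteq> 7 + 4 * l" "6 + 4 * k \<noteq> 8 + 4 * l" "7 + 4 * k \<noteq> 8 + 4 * l" for k l :: nat
    using mod4[of k] mod4[of l] by fastforce+
  show "goedel p = goedel q \<Longrightarrow> p = q" for p q
    by (induction p arbitrary: q; case_tac q; simp add: neq neq[symmetric])
qed

lemma surj_goedel: "surj goedel"
proof -
  have "\<exists>p. goedel p = n" for n
  proof (induction n rule: less_induct)
    case (less n)
    show ?case
    proof (cases "n < 5")
      case True
      then have "n = 0 \<or> n = 1 \<or> n = 2 \<or> n = 3 \<or> n = 4" by linarith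
      then show ?thesis by (metis goedel.simps(1-5))
    next
      case False
      define k where "k = (n - 5) div 4"
      have k: "k < n" using False by (simp add: k_def)
      obtain a b where ab: "k = prod_encode (a, b)" by (metis prod_decode_inverse surj_pair)
      then have "a < n" "b < n"
        using k le_prod_encode_1[of a b] le_prod_encode_2[of b a] by linarith+
      then obtain p q r where "goedel p = a" "goedel q = b" "goedel r = k"
        using less k by metis
      moreover have "n = 5 + 4 * k \<or> n = 6 + 4 * k \<or> n = 7 + 4 * k \<or> n = 8 + 4 * k"
        using False unfolding k_def by presburger
      ultimately show ?thesis using ab by (metis goedel.simps(6-9))
    qed
  qed
  then show ?thesis by (metis surjI)
qed

lemma bij_goedel: "bij goedel"
  using inj_goedel surj_goedel by (rule bijI)

definition compute :: "nat \<Rightarrow> baire \<Rightarrow> nat \<rightharpoonup> nat" where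
  "compute e g x =
    (if \<exists>y. eval g (inv goedel e) x y then Some (THE y. eval g (inv goedel e) x y) else None)"

lemma compute_eq_Some_iff: "compute e g x = Some y \<longleftrightarrow> eval g (inv goedel e) x y"
  unfolding compute_def by (auto intro: theI dest: eval_deterministic)

text \<open>
  The partial computable functions on the natural numbers are those computed with a trivial oracle;
  this is the usual convention that the \<open>e\<close>-th partial computable function is the \<open>e\<close>-th
  oracle computation relative to the empty set.
\<close>

definition partial_computable :: "nat \<Rightarrow> nat \<rightharpoonup> nat" where
  "partial_computable e = compute e (\<lambda>_. 0)"

text \<open>
  The \<open>e\<close>-th partial computable function on Baire space is defined at \<open>g\<close> iff the
  \<open>e\<close>-th oracle computation relative to \<open>g\<close> converges on every input.
\<close>

definition functional :: "nat \<Rightarrow> baire \<rightharpoonup> baire" where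
  "functional e g =
    (if \<forall>x. compute e g x \<noteq> None then Some (\<lambda>x. the (compute e g x)) else None)"


section \<open>Diagonally noncomputable functions\<close>

definition DNR :: "nat \<Rightarrow> baire set" where
  "DNR k = {f. (\<forall>n. f n < k) \<and> (\<forall>e v. partial_computable e e = Some v \<longrightarrow> f e \<noteq> v)}"


section \<open>Nonuniform and limit computability\<close>

definition learner :: "(nat list \<Rightarrow> nat) \<Rightarrow> bool" where
  "learner \<Psi> \<longleftrightarrow> (\<exists>e. \<forall>\<sigma>. partial_computable e (list_encode \<sigma>) = Some (\<Psi> \<sigma>))"

definition initial_segment :: "baire \<Rightarrow> nat \<Rightarrow> nat list" where
  "initial_segment g n = map g [0..<n]"

text \<open>The \<open>(<\<omega>, 1)\<close>-computable and the \<open>(1, \<omega>)\<close>-computable partial functions.\<close>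

definition finite_one_computable :: "(baire \<rightharpoonup> baire) \<Rightarrow> bool" where
  "finite_one_computable \<Gamma> \<longleftrightarrow> (\<exists>b. \<forall>g \<in> dom \<Gamma>. \<exists>e<b. functional e g = \<Gamma> g)"

definition one_omega_computable :: "(baire \<rightharpoonup> baire) \<Rightarrow> bool" where
  "one_omega_computable \<Gamma> \<longleftrightarrow>
    (\<exists>\<Psi>. learner \<Psi> \<and>
      (\<forall>g \<in> dom \<Gamma>. convergent (\<lambda>n. \<Psi> (initial_segment g n)) \<and>
        functional (lim (\<lambda>n. \<Psi> (initial_segment g n))) g = \<Gamma> g))"

text \<open>
  Reducibility between subsets of Baire space with respect to a class \<open>C\<close> of partial functions.
  The set \<open>A\<close> on the left is the one being solved from elements of \<open>B\<close>.
\<close>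

definition reducible :: "((baire \<rightharpoonup> baire) \<Rightarrow> bool) \<Rightarrow> baire set \<Rightarrow> baire set \<Rightarrow> bool" where
  "reducible C A B \<longleftrightarrow> (\<exists>\<Gamma>. C \<Gamma> \<and> B \<subseteq> dom \<Gamma> \<and> (\<forall>g \<in> B. the (\<Gamma> g) \<in> A))"

definition strictly_reducible ::
    "((baire \<rightharpoonup> baire) \<Rightarrow> bool) \<Rightarrow> baire set \<Rightarrow> baire set \<Rightarrow> bool" where
  "strictly_reducible C A B \<longleftrightarrow> reducible C A B \<and> \<not> reducible C B A"

end

theory Submission
  imports Defs
begin

text \<open>
  A single functional cannot solve \<open>DNR 2\<close> from \<open>DNR 3\<close>, even on one cone of \<open>DNR 3\<close>: a program that
  on input \<open>x\<close> searches for a value \<open>i\<close> which an opponent naming forbidden values one place after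
  another, consistently with the diagonal, cannot keep the functional from giving at \<open>x\<close>, and
  returns \<open>i\<close>, is answered wrongly at its own index. Such an \<open>i < 2\<close> exists because among the three
  possible values at a new place two lead to the same \<open>i\<close>, by pigeonhole.

  The two nonuniform cases reduce to this. If finitely many functionals suffice, pass to a cone on
  which as many of them as possible have given a wrong value, which is an open condition; there the
  remaining ones never err and one of them is always total, so the first value given by any of
  them is a uniform solution. If a learner suffices, then by a Baire category argument its guess is
  constant on some cone.
\<close>

abbreviation pair :: "nat \<Rightarrow> nat \<Rightarrow> nat" where
  "pair a b \<equiv> prod_encode (a, b)"

abbreviation pfst :: "nat \<Rightarrow> nat" where
  "pfst n \<equiv> fst (prod_decode n)"

abbreviation psnd :: "nat \<Rightarrow> nat" where
  "psnd n \<equiv> snd (prod_decode n)"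


section \<open>Total computable functions and decidable predicates\<close>

definition computable :: "(nat \<Rightarrow> nat) \<Rightarrow> bool" where
  "computable f \<longleftrightarrow> (\<exists>p. \<forall>g x. eval g p x (f x))"

definition decidable :: "(nat \<Rightarrow> bool) \<Rightarrow> bool" where
  "decidable P \<longleftrightarrow> computable (\<lambda>x. of_bool (P x))"

text \<open>Closure rules that follow the shape of a term, so that large predicates such as
  \<open>step\<close> are decided without writing programs.\<close>

named_theorems computable_intros

lemma computable_comp:
  assumes "computable f" "computable h"
  shows "computable (\<lambda>x. f (h x))"
  using assms unfolding computable_def by (meson eval.Comp)

lemma computable_id [computable_intros]: "computable (\<lambda>x. x)"
proof -
  have "eval g (Tuple Fst Snd) x x" for g x
    using eval.Tuple[OF eval.Fst eval.Snd, of g x] by simp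
  then show ?thesis unfolding computable_def by blast
qed

lemma computable_Suc [computable_intros]: "computable f \<Longrightarrow> computable (\<lambda>x. Suc (f x))"
  by (rule computable_comp[of Suc]) (auto simp: computable_def intro: eval.Succ)

lemma computable_pfst [computable_intros]: "computable f \<Longrightarrow> computable (\<lambda>x. pfst (f x))"
  by (rule computable_comp[of pfst]) (auto simp: computable_def intro: eval.Fst)

lemma computable_psnd [computable_intros]: "computable f \<Longrightarrow> computable (\<lambda>x. psnd (f x))"
  by (rule computable_comp[of psnd]) (auto simp: computable_def intro: eval.Snd)

lemma computable_pair [computable_intros]:
  "computable f \<Longrightarrow> computable h \<Longrightarrow> computable (\<lambda>x. pair (f x) (h x))"
  unfolding computable_def by (meson eval.Tuple)

lemma computable_0: "computable (\<lambda>x. 0)"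
  unfolding computable_def by (meson eval.Zero)

lemma computable_const [computable_intros]: "computable (\<lambda>x. n)"
  by (induction n) (auto intro: computable_0 computable_Suc)

text \<open>The arguments of \<open>h\<close> are unpacked in the order in which
  \<open>PrimRec\<close> packs them for its second program: parameter, counter, previous
  value.\<close>

lemma computable_rec_nat:
  assumes "computable f" "computable (\<lambda>z. h (pfst z) (pfst (psnd z)) (psnd (psnd z)))"
    and "computable k"
  shows "computable (\<lambda>x. rec_nat (f x) (h x) (k x))"
proof -
  obtain p q where p: "\<And>g x. eval g p x (f x)"
    and q: "\<And>g z. eval g q z (h (pfst z) (pfst (psnd z)) (psnd (psnd z)))"
    using assms unfolding computable_def by blast
  have rec: "eval g (PrimRec p q) (pair x n) (rec_nat (f x) (h x) n)" for g x n
  proof (induction n)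
    case 0
    show ?case using eval.PrimRec_0[OF p] by simp
  next
    case (Suc n)
    show ?case using eval.PrimRec_Suc[OF Suc q] by simp
  qed
  have "eval g (PrimRec p q) z (rec_nat (f (pfst z)) (h (pfst z)) (psnd z))" for g z
    using rec[of g "pfst z" "psnd z"] by simp
  then have "computable (\<lambda>z. rec_nat (f (pfst z)) (h (pfst z)) (psnd z))"
    unfolding computable_def by blast
  from computable_comp[OF this computable_pair[OF computable_id assms(3)]] show ?thesis
    by simp
qed

lemma computable_pred [computable_intros]:
  assumes "computable f" shows "computable (\<lambda>x. f x - 1)"
proof -
  have "rec_nat 0 (\<lambda>n y. n) n = n - 1" for n :: nat
    by (cases n) auto
  moreover have "computable (\<lambda>x. rec_nat 0 (\<lambda>n y. n) (f x))"
    by (intro computable_rec_nat computable_intros assms)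
  ultimately show ?thesis by simp
qed

lemma computable_add [computable_intros]:
  assumes "computable f" "computable h" shows "computable (\<lambda>x. f x + h x)"
proof -
  have "rec_nat m (\<lambda>n y. Suc y) n = m + n" for m n :: nat
    by (induction n) auto
  moreover have "computable (\<lambda>x. rec_nat (f x) (\<lambda>n y. Suc y) (h x))"
    by (intro computable_rec_nat computable_intros assms)
  ultimately show ?thesis by simp
qed

lemma computable_diff [computable_intros]:
  assumes "computable f" "computable h" shows "computable (\<lambda>x. f x - h x)"
proof -
  have "rec_nat m (\<lambda>n y. y - 1) n = m - n" for m n :: nat
    by (induction n) auto
  moreover have "computable (\<lambda>x. rec_nat (f x) (\<lambda>n y. y - 1) (h x))"
    by (intro computable_rec_nat computable_intros assms)
  ultimately show ?thesis by simp
qed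

lemma computable_if [computable_intros]:
  assumes "decidable P" "computable f" "computable h"
  shows "computable (\<lambda>x. if P x then f x else h x)"
proof -
  have "computable (\<lambda>x. rec_nat (h x) (\<lambda>n y. f x) (of_bool (P x)))"
    by (intro computable_rec_nat computable_comp[OF assms(2)] computable_intros assms
        assms(1)[unfolded decidable_def])
  moreover have "rec_nat (h x) (\<lambda>n y. f x) (of_bool (P x)) = (if P x then f x else h x)" for x
    by simp
  ultimately show ?thesis by simp
qed

lemma decidable_not [computable_intros]:
  assumes "decidable P" shows "decidable (\<lambda>x. \<not> P x)"
proof -
  have "computable (\<lambda>x. 1 - of_bool (P x))"
    using assms unfolding decidable_def by (intro computable_intros)
  moreover have "1 - of_bool (P x) = (of_bool (\<not> P x) :: nat)" for x
    by simp
  ultimately show ?thesis unfolding decidable_def by (simp only:)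
qed

lemma decidable_conj [computable_intros]:
  assumes "decidable P" "decidable Q" shows "decidable (\<lambda>x. P x \<and> Q x)"
proof -
  have "computable (\<lambda>x. if P x then of_bool (Q x) else 0)"
    using assms by (intro computable_intros) (auto simp: decidable_def)
  moreover have "(if P x then of_bool (Q x) else 0) = (of_bool (P x \<and> Q x) :: nat)" for x
    by simp
  ultimately show ?thesis unfolding decidable_def by simp
qed

lemma decidable_disj [computable_intros]:
  assumes "decidable P" "decidable Q" shows "decidable (\<lambda>x. P x \<or> Q x)"
proof -
  have "decidable (\<lambda>x. \<not> (\<not> P x \<and> \<not> Q x))"
    by (intro computable_intros assms)
  then show ?thesis by simp
qed

lemma decidable_less [computable_intros]:
  assumes "computable f" "computable h" shows "decidable (\<lambda>x. f x < h x)"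
proof -
  \<comment> \<open>With truncated subtraction, \<open>1 - (1 - d)\<close> is 0 for
    \<open>d = 0\<close> and 1 for positive \<open>d\<close>.\<close>
  have "computable (\<lambda>x. 1 - (1 - (h x - f x)))"
    by (intro computable_intros assms)
  moreover have "1 - (1 - (h x - f x)) = of_bool (f x < h x)" for x
    by auto
  ultimately show ?thesis unfolding decidable_def by simp
qed

lemma decidable_eq [computable_intros]:
  assumes "computable f" "computable h" shows "decidable (\<lambda>x. f x = h x)"
proof -
  have "decidable (\<lambda>x. \<not> f x < h x \<and> \<not> h x < f x)"
    by (intro computable_intros assms)
  moreover have "(\<not> f x < h x \<and> \<not> h x < f x) = (f x = h x)" for x
    by auto
  ultimately show ?thesis by simp
qed

lemma decidable_ex_less [computable_intros]:
  assumes "decidable (\<lambda>z. P (pfst z) (psnd z))" "computable k"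
  shows "decidable (\<lambda>x. \<exists>i < k x. P x i)"
proof -
  \<comment> \<open>Reindexing: in a recursion step the counter is \<open>pfst (psnd z)\<close>, as
    \<open>psnd z\<close> also carries the previous value.\<close>
  have "computable (\<lambda>z. of_bool (P (pfst z) (pfst (psnd z))))"
    using computable_comp[OF assms(1)[unfolded decidable_def],
        of "\<lambda>z. pair (pfst z) (pfst (psnd z))"]
    by (simp add: computable_intros)
  then have "decidable (\<lambda>z. P (pfst z) (pfst (psnd z)))"
    by (simp add: decidable_def)
  then have "computable (\<lambda>x. rec_nat 0 (\<lambda>n y. if P x n then 1 else y) (k x))"
    by (intro computable_rec_nat computable_intros assms)
  moreover have "rec_nat 0 (\<lambda>n y. if P x n then 1 else y) m = (of_bool (\<exists>i<m. P x i) :: nat)"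
    for x m
    by (induction m) (auto simp: less_Suc_eq)
  ultimately show ?thesis unfolding decidable_def by simp
qed

lemma decidable_all_less [computable_intros]:
  assumes "decidable (\<lambda>z. P (pfst z) (psnd z))" "computable k"
  shows "decidable (\<lambda>x. \<forall>i < k x. P x i)"
proof -
  have "decidable (\<lambda>x. \<not> (\<exists>i < k x. \<not> P x i))"
    by (intro computable_intros assms)
  then show ?thesis by simp
qed

text \<open>On codes, dropping a list element is \<open>w \<mapsto> psnd (w - 1)\<close>; the empty list \<open>0\<close> is a fixed point.\<close>

definition code_drop :: "nat \<Rightarrow> nat \<Rightarrow> nat" where
  "code_drop w i = rec_nat w (\<lambda>_ y. psnd (y - 1)) i"

abbreviation members :: "nat \<Rightarrow> nat set" where
  "members w \<equiv> set (list_decode w)"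

lemma list_decode_nz: "0 < w \<Longrightarrow> list_decode w = pfst (w - 1) # list_decode (psnd (w - 1))"
  by (cases w) (auto split: prod.split)

lemma prod_decode_0: "prod_decode 0 = (0, 0)"
  using prod_encode_inverse[of "(0, 0)"] by (simp add: prod_encode_def)

lemma list_decode_code_drop: "list_decode (code_drop w i) = drop i (list_decode w)"
proof (induction i)
  case 0
  show ?case by (simp add: code_drop_def)
next
  case (Suc i)
  have eq: "code_drop w (Suc i) = psnd (code_drop w i - 1)"
    by (simp add: code_drop_def)
  show ?case
  proof (cases "code_drop w i = 0")
    case True
    with Suc have "drop i (list_decode w) = []" by simp
    then show ?thesis using True by (simp add: eq prod_decode_0)
  next
    case False
    then show ?thesis using Suc list_decode_nz[of "code_drop w i"]
      by (metis eq drop_Suc drop_tl list.sel(3) neq0_conv)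
  qed
qed

text \<open>Turns quantifiers over list positions into quantifiers bounded by the code.\<close>

lemma length_le_list_encode: "length xs \<le> list_encode xs"
proof (induction xs)
  case (Cons x xs)
  then show ?case using le_prod_encode_2[of "list_encode xs" x] by simp
qed simp

lemma code_drop_pos_iff: "0 < code_drop w i \<longleftrightarrow> i < length (list_decode w)"
proof -
  have "code_drop w i = 0 \<longleftrightarrow> list_decode (code_drop w i) = []"
    by (metis list_decode.simps(1) list_decode_inverse list_encode.simps(1))
  then show ?thesis
    by (metis drop_eq_Nil linorder_not_le list_decode_code_drop neq0_conv)
qed

lemma code_drop_nth:
  assumes "i < length (list_decode w)"
  shows "pfst (code_drop w i - 1) = list_decode w ! i"
    and "list_decode (psnd (code_drop w i - 1)) = drop (Suc i) (list_decode w)"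
proof -
  have "pfst (code_drop w i - 1) # list_decode (psnd (code_drop w i - 1))
      = list_decode w ! i # drop (Suc i) (list_decode w)"
    using assms list_decode_nz[of "code_drop w i"]
    by (metis Cons_nth_drop_Suc code_drop_pos_iff list_decode_code_drop)
  then show "pfst (code_drop w i - 1) = list_decode w ! i"
    and "list_decode (psnd (code_drop w i - 1)) = drop (Suc i) (list_decode w)" by auto
qed

lemma length_list_decode_le: "length (list_decode w) \<le> w"
  using length_le_list_encode[of "list_decode w"] by simp

lemma computable_code_drop [computable_intros]:
  assumes "computable f" "computable h" shows "computable (\<lambda>x. code_drop (f x) (h x))"
  unfolding code_drop_def by (intro computable_rec_nat computable_intros assms)

lemma decidable_comp:
  assumes "decidable P" "computable f" shows "decidable (\<lambda>x. P (f x))"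
  using assms computable_comp[of "\<lambda>x. of_bool (P x)" f] unfolding decidable_def by simp

text \<open>A member is the head of some drop of the code. Positions range below the code itself,
  and a positive drop means that the position lies inside the list.\<close>

lemma decidable_bex_members [computable_intros]:
  assumes "decidable (\<lambda>z. P (pfst z) (psnd z))" "computable k"
  shows "decidable (\<lambda>x. \<exists>u \<in> members (k x). P x u)"
proof -
  have k: "computable (\<lambda>z. k (pfst z))"
    by (rule computable_comp[OF assms(2)]) (intro computable_intros)
  have "computable (\<lambda>z. pair (pfst z) (pfst (code_drop (k (pfst z)) (psnd z) - 1)))"
    by (intro computable_intros k)
  from decidable_comp[OF assms(1) this]
  have "decidable (\<lambda>z. P (pfst z) (pfst (code_drop (k (pfst z)) (psnd z) - 1)))"
    by simp
  then have "decidable (\<lambda>x. \<exists>i < k x. 0 < code_drop (k x) i \<and> P x (pfst (code_drop (k x) i - 1)))"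
    by (intro computable_intros k assms)
  moreover have "(\<exists>i < w. 0 < code_drop w i \<and> Q (pfst (code_drop w i - 1)))
      \<longleftrightarrow> (\<exists>u \<in> members w. Q u)" for w and Q :: "nat \<Rightarrow> bool"
    using length_list_decode_le[of w] code_drop_nth(1)[of _ w]
    by (metis code_drop_pos_iff in_set_conv_nth order_less_le_trans)
  ultimately show ?thesis by simp
qed

lemma decidable_ball_members [computable_intros]:
  assumes "decidable (\<lambda>z. P (pfst z) (psnd z))" "computable k"
  shows "decidable (\<lambda>x. \<forall>u \<in> members (k x). P x u)"
proof -
  have "decidable (\<lambda>x. \<not> (\<exists>u \<in> members (k x). \<not> P x u))"
    by (intro computable_intros assms)
  then show ?thesis by simp
qed

lemma decidable_mem [computable_intros]:
  assumes "computable f" "computable k"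
  shows "decidable (\<lambda>x. f x \<in> members (k x))"
proof -
  have "computable (\<lambda>z. f (pfst z))"
    by (rule computable_comp[OF assms(1)]) (intro computable_intros)
  then have "decidable (\<lambda>x. \<exists>u \<in> members (k x). u = f x)"
    by (intro computable_intros assms)
  then show ?thesis by simp
qed


section \<open>Derivations\<close>

abbreviation judgement :: "nat \<Rightarrow> nat \<Rightarrow> nat \<Rightarrow> nat \<Rightarrow> nat" where
  "judgement s q x y \<equiv> pair (pair s (pair q x)) y"

text \<open>
  A finite partial oracle is coded as a list \<open>s\<close> of pairs of arguments and values. For \<open>q = Suc e\<close> the
  judgement says that the \<open>e\<close>-th program gives \<open>y\<close> on input \<open>x\<close> and oracle \<open>s\<close>. For \<open>q = 0\<close> it says that
  \<open>y\<close> can be forced from position \<open>s\<close> as the value at \<open>x\<close> of some functional with index in the list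
  \<open>c\<close>, whatever values the opponent forbids: at a new place \<open>n\<close> either two extensions win, or one wins
  whose value is known to differ from the diagonal value at \<open>n\<close>.
\<close>

definition step :: "nat \<Rightarrow> nat \<Rightarrow> nat \<Rightarrow> nat \<Rightarrow> nat \<Rightarrow> nat set \<Rightarrow> bool" where
  "step c s q x y S \<longleftrightarrow>
    q = 1 \<and> y = 0 \<or>
    q = 2 \<and> y = Suc x \<or>
    q = 3 \<and> y = pfst x \<or>
    q = 4 \<and> y = psnd x \<or>
    q = 5 \<and> pair x y \<in> members s \<or>
    (\<exists>k < q. q = 6 + (k + k + k + k) \<and>
      judgement s (Suc (pfst k)) x (pfst y) \<in> S \<and> judgement s (Suc (psnd k)) x (psnd y) \<in> S) \<or>
    (\<exists>k < q. q = 7 + (k + k + k + k) \<and>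
      (\<exists>j \<in> S. pfst j = pair s (pair (Suc (psnd k)) x) \<and>
        judgement s (Suc (pfst k)) (psnd j) y \<in> S)) \<or>
    (\<exists>k < q. q = 8 + (k + k + k + k) \<and>
      (psnd x = 0 \<and> judgement s (Suc (pfst k)) (pfst x) y \<in> S \<or>
       0 < psnd x \<and> (\<exists>j \<in> S. pfst j = pair s (pair q (pair (pfst x) (psnd x - 1))) \<and>
         judgement s (Suc (psnd k)) (pair (pfst x) (pair (psnd x - 1) (psnd j))) y \<in> S))) \<or>
    (\<exists>k < q. q = 9 + (k + k + k + k) \<and> judgement s (Suc k) (pair x y) 0 \<in> S \<and>
      (\<forall>m < y. \<exists>j \<in> S. pfst j = pair s (pair (Suc k) (pair x m)) \<and> 0 < psnd j)) \<or>
    q = 0 \<and> (\<exists>j \<in> members c. judgement s (Suc j) x y \<in> S) \<or>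
    q = 0 \<and> (\<exists>n < Suc s. (\<forall>u \<in> members s. pfst u \<noteq> n) \<and>
      (\<exists>a < 3. judgement (Suc (pair (pair n a) s)) 0 x y \<in> S \<and>
        ((\<exists>b < 3. b \<noteq> a \<and> judgement (Suc (pair (pair n b) s)) 0 x y \<in> S) \<or>
         (\<exists>j \<in> S. psnd (pfst j) = pair (Suc n) n \<and>
           (\<forall>u \<in> members (pfst (pfst j)). psnd u = 0) \<and> psnd j \<noteq> a))))"

text \<open>The earlier judgements \<open>S\<close> occur only positively in
  \<open>step\<close>.\<close>

lemma step_mono:
  assumes "step c s q x y S" "S \<subseteq> T"
  shows "step c s q x y T"
proof -
  \<comment> \<open>\<open>bex'\<close> handles quantifiers over a fixed list such as
    \<open>members c\<close>, and \<open>bex\<close> those over \<open>S\<close> itself.\<close>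
  have bex': "(\<And>j. P j \<longrightarrow> Q j) \<Longrightarrow> (\<exists>j \<in> A. P j) \<longrightarrow> (\<exists>j \<in> A. Q j)"
    for P Q and A :: "nat set" by blast
  have bex: "(\<And>j. P j \<longrightarrow> Q j) \<Longrightarrow> (\<exists>j \<in> S. P j) \<longrightarrow> (\<exists>j \<in> T. Q j)" for P Q
    using assms(2) by blast
  have "step c s q x y S \<longrightarrow> step c s q x y T"
    unfolding step_def
    by (intro imp_refl bex in_mono[OF assms(2)] disj_mono conj_mono ex_mono all_mono imp_mono bex')
  then show ?thesis using assms(1) by blast
qed

text \<open>In \<open>step\<close> every quantifier is bounded by a number or a list, and
  \<open>4 * k\<close> is written as a sum, so that the closure rules apply.\<close>

lemma decidable_step:
  assumes "computable s" "computable q" "computable x" "computable y" "computable k"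
  shows "decidable (\<lambda>z. step c (s z) (q z) (x z) (y z) (members (k z)))"
proof -
  \<comment> \<open>Below a quantifier the parameters appear composed with projections.\<close>
  have c: "computable (\<lambda>z. s (f z))" "computable (\<lambda>z. q (f z))" "computable (\<lambda>z. x (f z))"
    "computable (\<lambda>z. y (f z))" "computable (\<lambda>z. k (f z))" if "computable f" for f
    using that assms by (blast intro: computable_comp)+
  show ?thesis
    unfolding step_def by (intro computable_intros c assms)
qed


section \<open>Derivations as finite lists of judgements\<close>

primrec derivation :: "nat \<Rightarrow> nat list \<Rightarrow> bool" where
  "derivation c [] \<longleftrightarrow> True"
| "derivation c (j # L) \<longleftrightarrow>
    step c (pfst (pfst j)) (pfst (psnd (pfst j))) (psnd (psnd (pfst j))) (psnd j) (set L) \<and>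
    derivation c L"

text \<open>The judgement stands at the head, so that a search over codes of lists can read its
  value off directly.\<close>

definition derivable :: "nat \<Rightarrow> nat \<Rightarrow> nat \<Rightarrow> nat \<Rightarrow> nat \<Rightarrow> bool" where
  "derivable c s q x y \<longleftrightarrow> (\<exists>L. derivation c (judgement s q x y # L))"

lemma derivation_append: "derivation c L \<Longrightarrow> derivation c M \<Longrightarrow> derivation c (L @ M)"
  by (induction L) (auto intro: step_mono)

lemma derivation_drop: "derivation c L \<Longrightarrow> derivation c (drop n L)"
  by (induction L arbitrary: n) (auto simp: drop_Cons split: nat.split)

text \<open>Tails of derivations are derivations, so a derivation may be cut off at any judgement in
  it.\<close>

lemma derivable_iff_mem:
  "derivable c s q x y \<longleftrightarrow> (\<exists>L. derivation c L \<and> judgement s q x y \<in> set L)"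
proof
  assume "derivable c s q x y"
  then show "\<exists>L. derivation c L \<and> judgement s q x y \<in> set L"
    unfolding derivable_def by (meson list.set_intros(1))
next
  assume "\<exists>L. derivation c L \<and> judgement s q x y \<in> set L"
  then obtain L n where "derivation c L" "n < length L" "L ! n = judgement s q x y"
    by (metis in_set_conv_nth)
  then have "derivation c (judgement s q x y # drop (Suc n) L)"
    by (metis Cons_nth_drop_Suc derivation_drop)
  then show "derivable c s q x y" unfolding derivable_def by blast
qed

definition derivables :: "nat \<Rightarrow> nat set" where
  "derivables c = {j. \<exists>L. derivation c L \<and> j \<in> set L}"

lemma derivable_iff: "derivable c s q x y \<longleftrightarrow> judgement s q x y \<in> derivables c"
  by (simp add: derivable_iff_mem derivables_def)

text \<open>Derivations of the finitely many premises are appended to each other; by monotonicity,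
  extra earlier judgements do no harm.\<close>

lemma derivable_step:
  assumes "step c s q x y S" "finite S" "S \<subseteq> derivables c"
  shows "derivable c s q x y"
proof -
  have "\<exists>L. derivation c L \<and> S \<subseteq> set L"
    using assms(2,3)
  proof (induction S)
    case empty
    show ?case by (metis derivation.simps(1) empty_subsetI)
  next
    case (insert j S)
    then obtain L M where "derivation c L" "S \<subseteq> set L" "derivation c M" "j \<in> set M"
      by (auto simp: derivables_def)
    then have "derivation c (L @ M)" "insert j S \<subseteq> set (L @ M)"
      by (auto intro: derivation_append)
    then show ?case by blast
  qed
  then obtain L where "derivation c L" "S \<subseteq> set L" by blast
  then have "derivation c (judgement s q x y # L)"
    using step_mono[OF assms(1)] by simp
  then show ?thesis unfolding derivable_def by blast
qed

text \<open>Replaces the recursion by a bounded quantifier, to which the closure rules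
  apply.\<close>

lemma derivation_iff_nth:
  "derivation c L \<longleftrightarrow> (\<forall>i < length L.
    step c (pfst (pfst (L ! i))) (pfst (psnd (pfst (L ! i)))) (psnd (psnd (pfst (L ! i))))
      (psnd (L ! i)) (set (drop (Suc i) L)))"
proof (induction L)
  case (Cons j L)
  show ?case unfolding derivation.simps Cons length_Cons All_less_Suc2 by simp
qed simp

lemma decidable_derivation [computable_intros]:
  assumes "computable f" shows "decidable (\<lambda>x. derivation c (list_decode (f x)))"
proof -
  let ?j = "\<lambda>w i. pfst (code_drop w i - 1)"
  have "decidable (\<lambda>w. \<forall>i < w. \<not> 0 < code_drop w i \<or>
      step c (pfst (pfst (?j w i))) (pfst (psnd (pfst (?j w i)))) (psnd (psnd (pfst (?j w i))))
        (psnd (?j w i)) (members (psnd (code_drop w i - 1))))"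
    by (intro computable_intros decidable_step)
  moreover have "(\<forall>i < w. \<not> 0 < code_drop w i \<or>
      step c (pfst (pfst (?j w i))) (pfst (psnd (pfst (?j w i)))) (psnd (psnd (pfst (?j w i))))
        (psnd (?j w i)) (members (psnd (code_drop w i - 1))))
    \<longleftrightarrow> derivation c (list_decode w)" for w
  proof -
    \<comment> \<open>Positions outside the list satisfy the guarded condition vacuously.\<close>
    have bound: "(\<And>i. i < l \<Longrightarrow> A i = B i) \<Longrightarrow> l \<le> w \<Longrightarrow>
        (\<forall>i < w. \<not> i < l \<or> A i) \<longleftrightarrow> (\<forall>i < l. B i)" for A B and l :: nat
      by (meson order_less_le_trans)
    show ?thesis
      unfolding derivation_iff_nth code_drop_pos_iff
      by (rule bound) (simp_all only: code_drop_nth length_list_decode_le)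
  qed
  ultimately have "decidable (\<lambda>w. derivation c (list_decode w))" by simp
  then show ?thesis using assms by (rule decidable_comp)
qed

text \<open>Derivability is recursively enumerable: search for the least code of a derivation with a
  suitable head. If several values are derivable, the search chooses one.\<close>

lemma partial_computable_search:
  "\<exists>e. \<forall>x. (\<exists>y. derivable c s q x y) \<longrightarrow>
    (\<exists>y. partial_computable e x = Some y \<and> derivable c s q x y)"
proof -
  \<comment> \<open>\<open>w - 1\<close> undoes the \<open>Suc\<close> of a nonempty list code, so
    \<open>pfst (w - 1)\<close> is the head judgement; its value is left open.\<close>
  define P where "P x w \<longleftrightarrow> 0 < w \<and> derivation c (list_decode w) \<and>
    pfst (pfst (w - 1)) = pair s (pair q x)" for x w
  \<comment> \<open>\<open>Mu\<close> looks for a zero, so 0 stands for success.\<close>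
  have "computable (\<lambda>z. if P (pfst z) (psnd z) then 0 else 1)"
    unfolding P_def by (intro computable_intros)
  then obtain p where p: "\<And>g z. eval g p z (if P (pfst z) (psnd z) then 0 else 1)"
    unfolding computable_def by blast
  have "computable (\<lambda>w. psnd (pfst (w - 1)))" by (intro computable_intros)
  then obtain r where r: "\<And>g w. eval g r w (psnd (pfst (w - 1)))"
    unfolding computable_def by blast
  have head: "list_decode w = judgement s q x (psnd (pfst (w - 1))) # list_decode (psnd (w - 1))"
    if "P x w" for x w
    using that list_decode_nz[of w] unfolding P_def by (metis prod.collapse prod_decode_inverse)
  show ?thesis
  proof (rule exI[of _ "goedel (Comp r (Mu p))"], intro allI impI)
    fix x assume "\<exists>y. derivable c s q x y"
    then obtain y L where L: "derivation c (judgement s q x y # L)"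
      unfolding derivable_def by blast
    have "P x (list_encode (judgement s q x y # L))"
      unfolding P_def list_encode_inverse using L by simp
    then have w: "P x (LEAST w. P x w)" (is "P x ?w") by (rule LeastI)
    have "eval g (Mu p) x ?w" for g
    proof (rule eval.Mu)
      show "eval g p (pair x ?w) 0" using p[of g "pair x ?w"] w by simp
      show "\<exists>y>0. eval g p (pair x m) y" if "m < ?w" for m
        using p[of g "pair x m"] not_less_Least[OF that] by auto
    qed
    then have "eval g (Comp r (Mu p)) x (psnd (pfst (?w - 1)))" for g
      using r by (rule eval.Comp)
    then have "partial_computable (goedel (Comp r (Mu p))) x = Some (psnd (pfst (?w - 1)))"
      unfolding partial_computable_def compute_eq_Some_iff inv_f_f[OF inj_goedel] .
    moreover have "derivation c (list_decode ?w)" using w by (simp add: P_def)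
    then have "derivable c s q x (psnd (pfst (?w - 1)))"
      unfolding head[OF w] derivable_def by (rule exI)
    ultimately show "\<exists>y. partial_computable (goedel (Comp r (Mu p))) x = Some y \<and>
        derivable c s q x y" by blast
  qed
qed


section \<open>Soundness of derivations\<close>

definition extends :: "baire \<Rightarrow> nat \<Rightarrow> bool" where
  "extends g s \<longleftrightarrow> (\<forall>u \<in> members s. g (pfst u) = psnd u)"

abbreviation evals :: "baire \<Rightarrow> nat \<Rightarrow> nat \<Rightarrow> nat \<Rightarrow> bool" where
  "evals g e x y \<equiv> eval g (inv goedel e) x y"

lemma inv_goedel_simps:
  "inv goedel 0 = Zero" "inv goedel 1 = Succ" "inv goedel 2 = Fst" "inv goedel 3 = Snd"
  "inv goedel 4 = Oracle"
  "inv goedel (5 + 4 * k) = Tuple (inv goedel (pfst k)) (inv goedel (psnd k))"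
  "inv goedel (6 + 4 * k) = Comp (inv goedel (pfst k)) (inv goedel (psnd k))"
  "inv goedel (7 + 4 * k) = PrimRec (inv goedel (pfst k)) (inv goedel (psnd k))"
  "inv goedel (8 + 4 * k) = Mu (inv goedel k)"
proof -
  have goedel_inv: "goedel (inv goedel n) = n" for n
    by (rule surj_f_inv_f[OF surj_goedel])
  show "inv goedel 0 = Zero" "inv goedel 1 = Succ" "inv goedel 2 = Fst" "inv goedel 3 = Snd"
    "inv goedel 4 = Oracle"
    "inv goedel (5 + 4 * k) = Tuple (inv goedel (pfst k)) (inv goedel (psnd k))"
    "inv goedel (6 + 4 * k) = Comp (inv goedel (pfst k)) (inv goedel (psnd k))"
    "inv goedel (7 + 4 * k) = PrimRec (inv goedel (pfst k)) (inv goedel (psnd k))"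
    "inv goedel (8 + 4 * k) = Mu (inv goedel k)"
    by (rule inv_f_eq[OF inj_goedel], simp add: goedel_inv)+
qed

lemma evals_basic:
  "evals g 0 x 0" "evals g 1 x (Suc x)" "evals g 2 x (pfst x)" "evals g 3 x (psnd x)"
  unfolding inv_goedel_simps by (rule eval.intros)+

lemma evals_Oracle: "g x = y \<Longrightarrow> evals g 4 x y"
  using eval.Oracle[of g x] by (simp add: inv_goedel_simps)

lemma evals_Tuple:
  "evals g (pfst k) x (pfst y) \<Longrightarrow> evals g (psnd k) x (psnd y) \<Longrightarrow> evals g (5 + 4 * k) x y"
  unfolding inv_goedel_simps using eval.Tuple[of g _ x "pfst y" _ "psnd y"] by simp

lemma evals_Comp:
  "evals g (psnd k) x y \<Longrightarrow> evals g (pfst k) y z \<Longrightarrow> evals g (6 + 4 * k) x z"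
  unfolding inv_goedel_simps by (rule eval.Comp)

lemma evals_PrimRec_0:
  "psnd x = 0 \<Longrightarrow> evals g (pfst k) (pfst x) y \<Longrightarrow> evals g (7 + 4 * k) x y"
  unfolding inv_goedel_simps using eval.PrimRec_0[of g _ "pfst x" y]
  by (metis prod.collapse prod_decode_inverse)

lemma evals_PrimRec_Suc:
  assumes "0 < psnd x" "evals g (7 + 4 * k) (pair (pfst x) (psnd x - 1)) y"
    and "evals g (psnd k) (pair (pfst x) (pair (psnd x - 1) y)) z"
  shows "evals g (7 + 4 * k) x z"
proof -
  have "evals g (7 + 4 * k) (pair (pfst x) (Suc (psnd x - 1))) z"
    using assms(2,3) unfolding inv_goedel_simps by (rule eval.PrimRec_Suc)
  then show ?thesis using assms(1) by simp
qed

lemma evals_Mu: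
  "evals g k (pair x n) 0 \<Longrightarrow> (\<And>m. m < n \<Longrightarrow> \<exists>y>0. evals g k (pair x m) y) \<Longrightarrow>
    evals g (8 + 4 * k) x n"
  unfolding inv_goedel_simps by (rule eval.Mu)

text \<open>Case 0 records what a win guarantees: some play obeying the diagonal reaches the value.
  It has a premise because a strategy may pass through positions that no member of
  \<open>DNR 3\<close> extends. The other case covers all oracles, among them the zero oracle that
  defines the diagonal.\<close>

definition valid :: "nat \<Rightarrow> nat \<Rightarrow> nat \<Rightarrow> nat \<Rightarrow> nat \<Rightarrow> bool" where
  "valid c s q x y \<longleftrightarrow> (case q of
      0 \<Rightarrow> (\<exists>g \<in> DNR 3. extends g s) \<longrightarrow>
        (\<exists>g \<in> DNR 3. extends g s \<and> (\<exists>j \<in> members c. evals g j x y))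
    | Suc e \<Rightarrow> (\<forall>g. extends g s \<longrightarrow> evals g e x y))"

lemma valid_Suc: "valid c s (Suc e) x y \<longleftrightarrow> (\<forall>g. extends g s \<longrightarrow> evals g e x y)"
  by (simp add: valid_def)

lemma valid_0: "valid c s 0 x y \<longleftrightarrow> (\<exists>g \<in> DNR 3. extends g s) \<longrightarrow>
    (\<exists>g \<in> DNR 3. extends g s \<and> (\<exists>j \<in> members c. evals g j x y))"
  by (simp add: valid_def)

lemma DNR_upd:
  assumes "g \<in> DNR k" "a < k" "partial_computable n n \<noteq> Some a"
  shows "g(n := a) \<in> DNR k"
  using assms by (auto simp: DNR_def)

lemma extends_cons [simp]:
  "extends g (Suc (pair (pair n a) s)) \<longleftrightarrow> g n = a \<and> extends g s"
  by (simp add: extends_def)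

lemma extends_upd_fresh:
  "extends g s \<Longrightarrow> \<forall>u \<in> members s. pfst u \<noteq> n \<Longrightarrow> extends (g(n := a)) s"
  by (simp add: extends_def)

lemma valid_extend:
  assumes "valid c (Suc (pair (pair n a) s)) 0 x y" "\<forall>u \<in> members s. pfst u \<noteq> n"
    and "g \<in> DNR 3" "extends g s" "a < 3" "partial_computable n n \<noteq> Some a"
  shows "\<exists>g \<in> DNR 3. extends g s \<and> (\<exists>j \<in> members c. evals g j x y)"
proof -
  have "g(n := a) \<in> DNR 3" "extends (g(n := a)) (Suc (pair (pair n a) s))"
    using assms DNR_upd extends_upd_fresh by auto
  then show ?thesis using assms(1) unfolding valid_def by fastforce
qed

text \<open>The zero oracle extends every position whose values are all 0.\<close>

lemma valid_zero_oracle: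
  assumes "valid c s (Suc n) n v" "\<forall>u \<in> members s. psnd u = 0"
  shows "partial_computable n n = Some v"
  using assms unfolding valid_def partial_computable_def compute_eq_Some_iff
  by (simp add: extends_def)

lemma valid_step:
  assumes "step c s q x y S" and S: "\<And>s q x y. judgement s q x y \<in> S \<Longrightarrow> valid c s q x y"
  shows "valid c s q x y"
proof -
  have S': "valid c s q x (psnd j)" if "j \<in> S" "pfst j = pair s (pair q x)" for s q x j
    using S that by (metis prod.collapse prod_decode_inverse)
  \<comment> \<open>As \<open>q = 0\<close> is taken by the game, program codes appear in
    \<open>step\<close> shifted by one: the constants 6 to 9 there belong to the codes 5 to
    8.\<close>
  have four: "k + k + k + k = 4 * k" for k :: nat by simp
  \<comment> \<open>One case for each way in which a clause can hold, with membership in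
    \<open>S\<close> already replaced by validity.\<close>
  from assms(1) consider
      "q = 1" "y = 0" | "q = 2" "y = Suc x" | "q = 3" "y = pfst x" | "q = 4" "y = psnd x"
    | "q = 5" "pair x y \<in> members s"
    | (tuple) k where "q = Suc (5 + 4 * k)"
      "valid c s (Suc (pfst k)) x (pfst y)" "valid c s (Suc (psnd k)) x (psnd y)"
    | (comp) k v where "q = Suc (6 + 4 * k)"
      "valid c s (Suc (psnd k)) x v" "valid c s (Suc (pfst k)) v y"
    | (rec0) k where "q = Suc (7 + 4 * k)" "psnd x = 0" "valid c s (Suc (pfst k)) (pfst x) y"
    | (recS) k v where "q = Suc (7 + 4 * k)" "0 < psnd x"
      "valid c s q (pair (pfst x) (psnd x - 1)) v"
      "valid c s (Suc (psnd k)) (pair (pfst x) (pair (psnd x - 1) v)) y"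
    | (mu) k where "q = Suc (8 + 4 * k)" "valid c s (Suc k) (pair x y) 0"
      "\<And>m. m < y \<Longrightarrow> \<exists>v>0. valid c s (Suc k) (pair x m) v"
    | (win) j where "q = 0" "j \<in> members c" "valid c s (Suc j) x y"
    | (split) n a b where "q = 0" "\<forall>u \<in> members s. pfst u \<noteq> n" "a < 3" "b < 3" "b \<noteq> a"
      "valid c (Suc (pair (pair n a) s)) 0 x y" "valid c (Suc (pair (pair n b) s)) 0 x y"
    | (diag) n a v z where "q = 0" "\<forall>u \<in> members s. pfst u \<noteq> n" "a < 3" "v \<noteq> a"
      "valid c (Suc (pair (pair n a) s)) 0 x y" "valid c z (Suc n) n v"
      "\<forall>u \<in> members z. psnd u = 0"
  proof -
    from assms(1)[unfolded step_def] show thesis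
    proof (elim disjE exE conjE bexE, goal_cases)
      case 1 then show ?case by (rule that(1))
    next
      case 2 then show ?case by (rule that(2))
    next
      case 3 then show ?case by (rule that(3))
    next
      case 4 then show ?case by (rule that(4))
    next
      case 5 then show ?case by (rule that(5))
    next
      case (6 k)
      show ?case by (rule that(6)[of k]) (use 6 S in \<open>simp_all add: four\<close>)
    next
      case (7 k j)
      show ?case by (rule that(7)[of k "psnd j"]) (use 7 S S' in \<open>simp_all add: four\<close>)
    next
      case (8 k)
      show ?case by (rule that(8)[of k]) (use 8 S in \<open>simp_all add: four\<close>)
    next
      case (9 k j)
      show ?case by (rule that(9)[of k "psnd j"]) (use 9 S S' in \<open>simp_all add: four\<close>)
    next
      case (10 k)
      have "\<exists>v>0. valid c s (Suc k) (pair x m) v" if "m < y" for m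
        using 10(4) that S' by metis
      then show ?case by (intro that(10)[of k]) (use 10 S in \<open>simp_all add: four\<close>)
    next
      case (11 j)
      show ?case by (rule that(11)[of j]) (use 11 S in simp_all)
    next
      case (12 n a b)
      show ?case by (rule that(12)[of n a b]) (use 12 S in simp_all)
    next
      case (13 n a j)
      have "pfst j = pair (pfst (pfst j)) (pair (Suc n) n)"
        using 13 by (metis prod.collapse prod_decode_inverse)
      then show ?case
        by (intro that(13)[of n a "psnd j" "pfst (pfst j)"]) (use 13 S S' in simp_all)
    qed
  qed
  then show ?thesis
  proof cases
    case 5
    then have q: "q = Suc 4" by simp
    have "g x = y" if "extends g s" for g
      using 5(2) that unfolding extends_def by (metis fst_conv snd_conv prod_encode_inverse)
    then show ?thesis unfolding q valid_Suc by (blast intro: evals_Oracle)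
  next
    case tuple
    then show ?thesis unfolding tuple(1) valid_Suc by (blast intro: evals_Tuple)
  next
    case comp
    then show ?thesis unfolding comp(1) valid_Suc by (blast intro: evals_Comp)
  next
    case rec0
    then show ?thesis unfolding rec0(1) valid_Suc by (blast intro: evals_PrimRec_0)
  next
    case recS
    then show ?thesis unfolding recS(1) valid_Suc by (blast intro: evals_PrimRec_Suc)
  next
    case mu
    show ?thesis unfolding mu(1) valid_Suc
    proof (intro allI impI evals_Mu)
      fix g assume g: "extends g s"
      show "evals g k (pair x y) 0" using mu(2) g by (simp add: valid_Suc)
      show "\<exists>v>0. evals g k (pair x m) v" if "m < y" for m
        using mu(3)[OF that] g by (auto simp: valid_Suc)
    qed
  next
    case win
    then show ?thesis unfolding win(1) valid_0 valid_Suc by blast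
  next
    case split
    show ?thesis
      unfolding split(1) valid_0[of _ s]
    proof (intro impI, elim bexE)
      fix g assume g: "g \<in> DNR 3" "extends g s"
      \<comment> \<open>At most one of the two values is the diagonal one, so at least one child
        contains a modification of \<open>g\<close> in \<open>DNR 3\<close>.\<close>
      have "partial_computable n n \<noteq> Some a \<or> partial_computable n n \<noteq> Some b"
        using split(5) by auto
      then show "\<exists>g \<in> DNR 3. extends g s \<and> (\<exists>j \<in> members c. evals g j x y)"
        using valid_extend[OF split(6,2) g split(3)] valid_extend[OF split(7,2) g split(4)] by blast
    qed
  next
    case diag
    \<comment> \<open>The judgement at \<open>z\<close> yields the true diagonal value
      \<open>v\<close>, so \<open>a\<close> is permitted.\<close>
    have "partial_computable n n \<noteq> Some a"
      using valid_zero_oracle[OF diag(6,7)] diag(4) by simp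
    then show ?thesis
      unfolding diag(1) valid_0[of _ s] using valid_extend[OF diag(5,2) _ _ diag(3)] by blast
  next
    case 1
    then show ?thesis using valid_Suc[of c s 0] evals_basic(1) by simp
  next
    case 2
    then show ?thesis using valid_Suc[of c s 1] evals_basic(2) by (simp add: numeral_2_eq_2)
  next
    case 3
    then show ?thesis using valid_Suc[of c s 2] evals_basic(3) by (simp add: eval_nat_numeral)
  next
    case 4
    then show ?thesis using valid_Suc[of c s 3] evals_basic(4) by (simp add: eval_nat_numeral)
  qed
qed

lemma derivable_valid: "derivable c s q x y \<Longrightarrow> valid c s q x y"
proof -
  have "derivation c L \<Longrightarrow> judgement s q x y \<in> set L \<Longrightarrow> valid c s q x y" for L
  proof (induction L arbitrary: s q x y)
    case (Cons j L)
    show ?case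
    proof (cases "j = judgement s q x y")
      case True
      then show ?thesis using valid_step[of c s q x y "set L"] Cons by simp
    next
      case False
      then show ?thesis using Cons by auto
    qed
  qed simp
  then show "derivable c s q x y \<Longrightarrow> valid c s q x y"
    unfolding derivable_iff_mem by blast
qed


section \<open>Completeness of derivations\<close>

text \<open>Newest value first, so that lengthening a prefix is literally the extension of a
  position in \<open>step\<close>.\<close>

primrec prefix_code :: "baire \<Rightarrow> nat \<Rightarrow> nat" where
  "prefix_code g 0 = 0"
| "prefix_code g (Suc n) = Suc (pair (pair n (g n)) (prefix_code g n))"

lemma members_prefix_code: "members (prefix_code g n) = (\<lambda>m. pair m (g m)) ` {..<n}"
  by (induction n) (auto simp: lessThan_Suc)

lemma extends_prefix_code: "extends h (prefix_code g n) \<longleftrightarrow> (\<forall>m<n. h m = g m)"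
  by (auto simp: extends_def members_prefix_code)

lemma prefix_code_cong: "\<forall>m<n. h m = g m \<Longrightarrow> prefix_code h n = prefix_code g n"
  by (induction n) auto

text \<open>The next place thus meets the bound \<open>n < Suc s\<close> in
  \<open>step\<close>.\<close>

lemma le_prefix_code: "n \<le> prefix_code g n"
proof (induction n)
  case (Suc n)
  then show ?case
    using le_prod_encode_2[of "prefix_code g n" "pair n (g n)"] by simp
qed simp

lemma derivable_Oracle: "x < n \<Longrightarrow> derivable c (prefix_code g n) 5 x (g x)"
  by (rule derivable_step[of _ _ _ _ _ "{}"]) (auto simp: step_def members_prefix_code)

lemma derivable_Tuple:
  assumes "derivable c s (Suc a) x y" "derivable c s (Suc b) x z"
  shows "derivable c s (Suc (5 + 4 * pair a b)) x (pair y z)"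
proof (rule derivable_step)
  let ?S = "{judgement s (Suc a) x y, judgement s (Suc b) x z}"
  \<comment> \<open>This is literally one disjunct of \<open>step\<close>, so propositional
    simplification suffices afterwards; the other constructors are treated alike.\<close>
  have "\<exists>k < Suc (5 + 4 * pair a b). Suc (5 + 4 * pair a b) = 6 + (k + k + k + k) \<and>
      judgement s (Suc (pfst k)) x (pfst (pair y z)) \<in> ?S \<and>
      judgement s (Suc (psnd k)) x (psnd (pair y z)) \<in> ?S"
    by (rule exI[of _ "pair a b"]) simp
  then show "step c s (Suc (5 + 4 * pair a b)) x (pair y z) ?S"
    by (simp only: step_def simp_thms)
qed (use assms in \<open>simp_all add: derivable_iff\<close>)

lemma derivable_Comp:
  assumes "derivable c s (Suc b) x y" "derivable c s (Suc a) y z"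
  shows "derivable c s (Suc (6 + 4 * pair a b)) x z"
proof (rule derivable_step)
  let ?S = "{judgement s (Suc b) x y, judgement s (Suc a) y z}"
  have "\<exists>k < Suc (6 + 4 * pair a b). Suc (6 + 4 * pair a b) = 7 + (k + k + k + k) \<and>
      (\<exists>j \<in> ?S. pfst j = pair s (pair (Suc (psnd k)) x) \<and>
        judgement s (Suc (pfst k)) (psnd j) z \<in> ?S)"
    by (rule exI[of _ "pair a b"]) simp
  then show "step c s (Suc (6 + 4 * pair a b)) x z ?S"
    by (simp only: step_def simp_thms)
qed (use assms in \<open>simp_all add: derivable_iff\<close>)

lemma derivable_PrimRec_0:
  assumes "derivable c s (Suc a) x y"
  shows "derivable c s (Suc (7 + 4 * pair a b)) (pair x 0) y"
proof (rule derivable_step)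
  let ?S = "{judgement s (Suc a) x y}" and ?q = "Suc (7 + 4 * pair a b)" and ?x = "pair x 0"
  have "\<exists>k < ?q. ?q = 8 + (k + k + k + k) \<and>
      (psnd ?x = 0 \<and> judgement s (Suc (pfst k)) (pfst ?x) y \<in> ?S \<or>
       0 < psnd ?x \<and> (\<exists>j \<in> ?S. pfst j = pair s (pair ?q (pair (pfst ?x) (psnd ?x - 1))) \<and>
         judgement s (Suc (psnd k)) (pair (pfst ?x) (pair (psnd ?x - 1) (psnd j))) y \<in> ?S))"
    by (rule exI[of _ "pair a b"]) simp
  then show "step c s ?q ?x y ?S"
    by (simp only: step_def simp_thms)
qed (use assms in \<open>simp_all add: derivable_iff\<close>)

lemma derivable_PrimRec_Suc:
  assumes "derivable c s (Suc (7 + 4 * pair a b)) (pair x n) y"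
    and "derivable c s (Suc b) (pair x (pair n y)) z"
  shows "derivable c s (Suc (7 + 4 * pair a b)) (pair x (Suc n)) z"
proof (rule derivable_step)
  let ?q = "Suc (7 + 4 * pair a b)" and ?x = "pair x (Suc n)"
  let ?S = "{judgement s ?q (pair x n) y, judgement s (Suc b) (pair x (pair n y)) z}"
  have "\<exists>k < ?q. ?q = 8 + (k + k + k + k) \<and>
      (psnd ?x = 0 \<and> judgement s (Suc (pfst k)) (pfst ?x) z \<in> ?S \<or>
       0 < psnd ?x \<and> (\<exists>j \<in> ?S. pfst j = pair s (pair ?q (pair (pfst ?x) (psnd ?x - 1))) \<and>
         judgement s (Suc (psnd k)) (pair (pfst ?x) (pair (psnd ?x - 1) (psnd j))) z \<in> ?S))"
    by (rule exI[of _ "pair a b"]) simp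
  then show "step c s ?q ?x z ?S"
    by (simp only: step_def simp_thms)
qed (use assms in \<open>simp_all add: derivable_iff\<close>)

lemma derivable_Mu:
  assumes "derivable c s (Suc a) (pair x n) 0"
    and "\<And>m. m < n \<Longrightarrow> 0 < f m \<and> derivable c s (Suc a) (pair x m) (f m)"
  shows "derivable c s (Suc (8 + 4 * a)) x n"
proof (rule derivable_step)
  let ?q = "Suc (8 + 4 * a)"
  let ?S = "insert (judgement s (Suc a) (pair x n) 0)
    ((\<lambda>m. judgement s (Suc a) (pair x m) (f m)) ` {..<n})"
  have "\<exists>k < ?q. ?q = 9 + (k + k + k + k) \<and> judgement s (Suc k) (pair x n) 0 \<in> ?S \<and>
      (\<forall>m < n. \<exists>j \<in> ?S. pfst j = pair s (pair (Suc k) (pair x m)) \<and> 0 < psnd j)"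
    by (rule exI[of _ a]) (use assms(2) in auto)
  then show "step c s ?q x n ?S"
    by (simp only: step_def simp_thms)
  show "?S \<subseteq> derivables c" using assms by (auto simp: derivable_iff)
qed simp

lemma derivable_win:
  assumes "j \<in> members c" "derivable c s (Suc j) x y"
  shows "derivable c s 0 x y"
proof (rule derivable_step)
  show "step c s 0 x y {judgement s (Suc j) x y}"
    using assms(1) by (auto simp: step_def)
qed (use assms in \<open>simp_all add: derivable_iff\<close>)

lemma derivable_split:
  assumes "derivable c (Suc (pair (pair n a) s)) 0 x y" "derivable c (Suc (pair (pair n b) s)) 0 x y"
    and "a < 3" "b < 3" "b \<noteq> a" "n \<le> s" "\<forall>u \<in> members s. pfst u \<noteq> n"
  shows "derivable c s 0 x y"
proof (rule derivable_step)
  let ?S = "{judgement (Suc (pair (pair n a) s)) 0 x y, judgement (Suc (pair (pair n b) s)) 0 x y}"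
  have "\<exists>b'<3. b' \<noteq> a \<and> judgement (Suc (pair (pair n b') s)) 0 x y \<in> ?S"
    using assms by blast
  then show "step c s 0 x y ?S"
    unfolding step_def using assms(3,6,7) by (metis insertI1 less_Suc_eq_le)
qed (use assms in \<open>simp_all add: derivable_iff\<close>)

lemma derivable_diag:
  assumes "derivable c (Suc (pair (pair n a) s)) 0 x y" "derivable c z (Suc n) n v"
    and "\<forall>u \<in> members z. psnd u = 0"
    and "a < 3" "v \<noteq> a" "n \<le> s" "\<forall>u \<in> members s. pfst u \<noteq> n"
  shows "derivable c s 0 x y"
proof (rule derivable_step)
  let ?S = "{judgement (Suc (pair (pair n a) s)) 0 x y, judgement z (Suc n) n v}"
  have "\<exists>j \<in> ?S. psnd (pfst j) = pair (Suc n) n \<and>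
      (\<forall>u \<in> members (pfst (pfst j)). psnd u = 0) \<and> psnd j \<noteq> a"
    using assms by simp
  then show "step c s 0 x y ?S"
    unfolding step_def using assms(4,6,7) by (metis insertI1 less_Suc_eq_le)
qed (use assms in \<open>simp_all add: derivable_iff\<close>)

text \<open>A convergent computation uses finitely much of the oracle. Speaking of all sufficiently
  long prefixes lets one prefix serve finitely many premises.\<close>

lemma eval_derivable:
  "eval g p x y \<Longrightarrow> \<forall>\<^sub>F n in sequentially. derivable c (prefix_code g n) (Suc (goedel p)) x y"
proof (induction rule: eval.induct)
  case (Oracle x)
  have "\<forall>\<^sub>F n in sequentially. x < n" by (rule eventually_gt_at_top)
  then show ?case by (rule eventually_mono) (use derivable_Oracle in simp)
next
  case (Tuple p x y q z)
  from Tuple.IH show ?case by eventually_elim (simp only: goedel.simps derivable_Tuple)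
next
  case (Comp q x y p z)
  from Comp.IH show ?case by eventually_elim (simp only: goedel.simps, rule derivable_Comp)
next
  case (PrimRec_0 p x y q)
  from PrimRec_0.IH show ?case
    by eventually_elim (simp only: goedel.simps, rule derivable_PrimRec_0)
next
  case (PrimRec_Suc p q x n y z)
  from PrimRec_Suc.IH show ?case
    by eventually_elim (simp only: goedel.simps, rule derivable_PrimRec_Suc)
next
  case (Mu p x n)
  let ?D = "\<lambda>m y k. derivable c (prefix_code g k) (Suc (goedel p)) (pair x m) y"
  obtain f where f: "\<And>m. m < n \<Longrightarrow> 0 < f m \<and> eventually (?D m (f m)) sequentially"
    using Mu.IH(2) by metis
  then have "\<forall>\<^sub>F k in sequentially. \<forall>m \<in> {..<n}. ?D m (f m) k"
    by (intro eventually_ball_finite) auto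
  with Mu.IH(1) show ?case
    by eventually_elim (simp only: goedel.simps, rule derivable_Mu[of _ _ _ _ _ f], use f in auto)
qed (rule always_eventually, rule allI, rule derivable_step[of _ _ _ _ _ "{}"]; simp add: step_def)+

lemma evals_derivable:
  "evals g e x y \<Longrightarrow> \<forall>\<^sub>F n in sequentially. derivable c (prefix_code g n) (Suc e) x y"
  using eval_derivable[of g "inv goedel e" x y c] by (simp add: surj_f_inv_f[OF surj_goedel])

text \<open>The use principle: completeness gives a derivation from a finite prefix, and soundness
  applies it to every oracle with that prefix.\<close>

lemma evals_finite_use:
  assumes "evals g e x y"
  shows "\<exists>n. \<forall>h. (\<forall>m<n. h m = g m) \<longrightarrow> evals h e x y"
proof -
  obtain n where "derivable 0 (prefix_code g n) (Suc e) x y"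
    using evals_derivable[OF assms] by (meson eventually_sequentially order_refl)
  then have "valid 0 (prefix_code g n) (Suc e) x y" by (rule derivable_valid)
  then show ?thesis by (auto simp: valid_def extends_prefix_code)
qed


section \<open>No uniform solution on a cone\<close>

text \<open>A fusion argument. Each stage freezes a longer prefix, and \<open>P\<close> inspects
  only that prefix. The limit is in \<open>DNR k\<close> because membership is a condition on each
  value separately.\<close>

lemma DNR_path:
  assumes "g0 \<in> DNR k" "P g0 n0"
    and cong: "\<And>g h n. \<forall>m<n. h m = g m \<Longrightarrow> P g n \<Longrightarrow> P h n"
    and step: "\<And>g n. g \<in> DNR k \<Longrightarrow> P g n \<Longrightarrow>
      \<exists>h \<in> DNR k. \<exists>l>n. (\<forall>m<n. h m = g m) \<and> P h l"
  shows "\<exists>g \<in> DNR k. (\<forall>m<n0. g m = g0 m) \<and> (\<forall>m. \<exists>n\<ge>m. P g n)"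
proof -
  define Q where "Q z \<longleftrightarrow> fst z \<in> DNR k \<and> P (fst z) (snd z)" for z :: "baire \<times> nat"
  define R where "R z z' \<longleftrightarrow> snd z < snd z' \<and> (\<forall>m < snd z. fst z' m = fst z m)"
    for z z' :: "baire \<times> nat"
  have "\<exists>z'. Q z' \<and> R z z'" if "Q z" for z
    using step[of "fst z" "snd z"] that unfolding Q_def R_def by (metis fst_conv snd_conv)
  moreover have "Q (g0, n0)" using assms by (simp add: Q_def)
  \<comment> \<open>The condition at index 0 fixes the start of the chain.\<close>
  ultimately obtain F where F: "F 0 = (g0, n0)" "\<And>i. Q (F i)" "\<And>i. R (F i) (F (Suc i))"
    using dependent_nat_choice[of "\<lambda>i z. Q z \<and> (i = 0 \<longrightarrow> z = (g0, n0))" "\<lambda>i. R"] by auto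
  define N where "N i = snd (F i)" for i
  have N: "strict_mono N"
    unfolding strict_mono_Suc_iff N_def using F(3) by (simp add: R_def)
  have agree: "fst (F j) m = fst (F i) m" if "i \<le> j" "m < N i" for i j m
    using that(1)
  proof (induction j rule: dec_induct)
    case (step j)
    have "m < N j" using that(2) step(1) strict_mono_less_eq[OF N] by (meson order_less_le_trans)
    then show ?case using F(3)[of j] step.IH by (simp add: R_def N_def)
  qed simp
  \<comment> \<open>\<open>N\<close> is strictly increasing, so stage \<open>Suc m\<close> has
    frozen the value at \<open>m\<close>.\<close>
  define g where "g m = fst (F (Suc m)) m" for m
  have g: "g m = fst (F i) m" if "m < N i" for i m
  proof -
    have "m < N (Suc m)" using strict_mono_imp_increasing[OF N, of "Suc m"] by simp
    then show ?thesis
      using agree[of i "Suc m" m] agree[of "Suc m" i m] that unfolding g_def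
      by (metis nat_le_linear)
  qed
  have "g \<in> DNR k"
    using F(2) unfolding DNR_def Q_def g_def by simp
  moreover have "\<forall>m<n0. g m = g0 m" using g[of _ 0] F(1) by (simp add: N_def)
  moreover have "P g (N i)" for i
    using cong[of "N i" g "fst (F i)"] g F(2) by (simp add: Q_def N_def)
  moreover have "m \<le> N m" for m using strict_mono_imp_increasing[OF N] .
  ultimately show ?thesis by blast
qed

text \<open>The opponent's reply at a position not yet lost. If the diagonal converges at
  \<open>n\<close>, a different value works, since a win there would by the diagonal clause be a win
  at \<open>s\<close>. If it diverges and all three children were won, two would be won with the
  same value.\<close>

lemma bad_child:
  assumes "\<forall>y<2. \<not> derivable c s 0 x y" "n \<le> s" "\<forall>u \<in> members s. pfst u \<noteq> n"
  shows "\<exists>a<3. partial_computable n n \<noteq> Some a \<and>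
    (\<forall>y<2. \<not> derivable c (Suc (pair (pair n a) s)) 0 x y)"
proof (cases "partial_computable n n")
  case (Some v)
  define a :: nat where "a = (if v = 0 then 1 else 0)"
  have a: "a < 3" "v \<noteq> a" by (auto simp: a_def)
  have "evals (\<lambda>_. 0) n n v"
    using Some unfolding partial_computable_def compute_eq_Some_iff .
  \<comment> \<open>A finite part of the zero oracle suffices to derive the diagonal value.\<close>
  then obtain k where "derivable c (prefix_code (\<lambda>_. 0) k) (Suc n) n v"
    using evals_derivable by (meson eventually_sequentially order_refl)
  then have "derivable c s 0 x y" if "derivable c (Suc (pair (pair n a) s)) 0 x y" for y
    using derivable_diag[OF that _ _ a assms(2,3)] by (simp add: members_prefix_code)
  then show ?thesis using a assms(1) Some by auto
next
  case None
  show ?thesis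
  proof (rule ccontr)
    assume "\<not> ?thesis"
    then obtain f where f: "\<And>a. a < 3 \<Longrightarrow> f a < (2::nat)"
      "\<And>a. a < 3 \<Longrightarrow> derivable c (Suc (pair (pair n a) s)) 0 x (f a)"
      using None by (metis option.distinct(1))
    have "f 0 < 2" "f 1 < 2" "f 2 < 2" using f(1) by auto
    then have "f 0 = f 1 \<or> f 0 = f 2 \<or> f 1 = f 2" by linarith
    moreover have "(0::nat) < 3" "(1::nat) < 3" "(2::nat) < 3" "(1::nat) \<noteq> 0" "(2::nat) \<noteq> 0" "(2::nat) \<noteq> 1"
      by simp_all
    ultimately obtain a b where "a < 3" "b < 3" "b \<noteq> a" "f a = f b"
      by metis
    then show False
      using derivable_split[OF f(2) _ _ _ _ assms(2,3), of a b] f assms(1) by metis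
  qed
qed

lemma no_uniform_solution_on_cone:
  assumes "finite J" "g0 \<in> DNR 3"
    and total: "\<And>g x. g \<in> DNR 3 \<Longrightarrow> \<forall>m<n0. g m = g0 m \<Longrightarrow> \<exists>j \<in> J. \<exists>y. evals g j x y"
    and sound: "\<And>g j x y. g \<in> DNR 3 \<Longrightarrow> \<forall>m<n0. g m = g0 m \<Longrightarrow> j \<in> J \<Longrightarrow>
      evals g j x y \<Longrightarrow> y < 2 \<and> partial_computable x x \<noteq> Some y"
  shows False
proof -
  obtain c where c: "members c = J"
    using finite_list[OF assms(1)] by (metis list_encode_inverse)
  let ?s = "prefix_code g0 n0"
  \<comment> \<open>\<open>e\<close> searches for a value forced from \<open>?s\<close> at its own
    input; it will be run on \<open>e\<close>.\<close>
  obtain e where e: "\<And>x. \<exists>y. derivable c ?s 0 x y \<Longrightarrow>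
      \<exists>y. partial_computable e x = Some y \<and> derivable c ?s 0 x y"
    using partial_computable_search[of c ?s 0] by blast
  have "\<exists>y. derivable c ?s 0 e y"
  proof (rule ccontr)
    assume none: "\<nexists>y. derivable c ?s 0 e y"
    \<comment> \<open>The opponent keeps both values below 2 unforced; these are the values that
      \<open>bad_child\<close> treats.\<close>
    define P where "P g n \<longleftrightarrow> (\<forall>y<2. \<not> derivable c (prefix_code g n) 0 e y)" for g n
    have "\<exists>g \<in> DNR 3. (\<forall>m<n0. g m = g0 m) \<and> (\<forall>m. \<exists>n\<ge>m. P g n)"
    proof (rule DNR_path)
      show "P g0 n0" using none by (simp add: P_def)
      show "P h n" if "\<forall>m<n. h m = g m" "P g n" for g h n
        using that prefix_code_cong[OF that(1)] by (simp add: P_def)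
      show "\<exists>h \<in> DNR 3. \<exists>l>n. (\<forall>m<n. h m = g m) \<and> P h l" if g: "g \<in> DNR 3" "P g n" for g n
      proof -
        obtain a where a: "a < 3" "partial_computable n n \<noteq> Some a"
          "\<forall>y<2. \<not> derivable c (Suc (pair (pair n a) (prefix_code g n))) 0 e y"
          using bad_child[of c "prefix_code g n" e n] g(2) le_prefix_code[of n g]
          by (auto simp: P_def members_prefix_code)
        have "P (g(n := a)) (Suc n)"
          using a(3) prefix_code_cong[of n "g(n := a)" g] by (simp add: P_def)
        then show ?thesis using DNR_upd[OF g(1) a(1,2)]
          by (intro bexI[of _ "g(n := a)"] exI[of _ "Suc n"]) auto
      qed
    qed (rule assms(2))
    then obtain g where g: "g \<in> DNR 3" "\<forall>m<n0. g m = g0 m" "\<And>m. \<exists>n\<ge>m. P g n" by blast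
    \<comment> \<open>\<open>sound\<close> puts \<open>y\<close> below 2, and every long prefix of
      \<open>g\<close> wins at once with \<open>y\<close> through \<open>j\<close>, although
      infinitely many prefixes are unforced.\<close>
    obtain j y where jy: "j \<in> J" "evals g j e y" using total[OF g(1,2)] by blast
    obtain k where "\<And>n. n \<ge> k \<Longrightarrow> derivable c (prefix_code g n) (Suc j) e y"
      using evals_derivable[OF jy(2)] by (metis eventually_sequentially)
    then show False
      using g(3)[of k] sound[OF g(1,2) jy] derivable_win[of j c] jy(1) c by (auto simp: P_def)
  qed
  then obtain y where y: "partial_computable e e = Some y" "derivable c ?s 0 e y"
    using e by blast
  \<comment> \<open>By soundness the forced value is really given at \<open>e\<close> by a
    functional on the cone, yet it is the diagonal value there.\<close>
  then obtain g j where "g \<in> DNR 3" "\<forall>m<n0. g m = g0 m" "j \<in> J" "evals g j e y"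
    using derivable_valid[OF y(2)] assms(2) c by (auto simp: valid_def extends_prefix_code)
  then show False using sound y(1) by blast
qed


section \<open>Nonuniform and limit computability\<close>

lemma functional_eq_SomeD: "functional e g = Some f \<Longrightarrow> evals g e x (f x)"
  unfolding functional_def by (auto split: if_splits simp flip: compute_eq_Some_iff)

lemma DNR_3_nonempty: "(\<lambda>e. if partial_computable e e = Some 0 then 1 else 0) \<in> DNR 3"
  by (auto simp: DNR_def)

lemma DNR_2_evals:
  assumes "functional e g = Some f" "f \<in> DNR 2" "evals g e x y"
  shows "y < 2 \<and> partial_computable x x \<noteq> Some y"
proof -
  have "y = f x" using functional_eq_SomeD[OF assms(1)] assms(3) eval_deterministic by blast
  then show ?thesis using assms(2) by (auto simp: DNR_def)
qed

lemma not_finite_one_reducible: "\<not> reducible finite_one_computable (DNR 2) (DNR 3)"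
proof
  assume "reducible finite_one_computable (DNR 2) (DNR 3)"
  then obtain \<Gamma> b where \<Gamma>: "\<And>g. g \<in> DNR 3 \<Longrightarrow> g \<in> dom \<Gamma> \<and> the (\<Gamma> g) \<in> DNR 2"
    "\<And>g. g \<in> dom \<Gamma> \<Longrightarrow> \<exists>e<b. functional e g = \<Gamma> g"
    unfolding reducible_def finite_one_computable_def by blast
  have sol: "\<exists>e<b. \<exists>f \<in> DNR 2. functional e g = Some f" if "g \<in> DNR 3" for g
    using \<Gamma>(1)[OF that] \<Gamma>(2)[of g] by (metis domD option.sel)
  \<comment> \<open>An error is witnessed by one computation, so it persists for all oracles sharing
    a long enough prefix with \<open>g\<close>.\<close>
  define wrong where "wrong e g \<longleftrightarrow>
    (\<exists>x y. evals g e x y \<and> \<not> (y < 2 \<and> partial_computable x x \<noteq> Some y))" for e g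
  \<comment> \<open>The conjunct \<open>g \<in> DNR 3\<close> keeps the cone nonempty.\<close>
  define killed where "killed K g n \<longleftrightarrow> g \<in> DNR 3 \<and>
    (\<forall>h \<in> DNR 3. (\<forall>m<n. h m = g m) \<longrightarrow> (\<forall>e \<in> K. wrong e h))" for K g n
  let ?A = "{K. K \<subseteq> {..<b} \<and> (\<exists>g n. killed K g n)}"
  have "{} \<in> ?A" using DNR_3_nonempty by (auto simp: killed_def)
  then have "?A \<noteq> {}" by blast
  moreover have "finite ?A" by simp
  ultimately have "\<exists>K \<in> ?A. \<forall>K' \<in> ?A. K \<subseteq> K' \<longrightarrow> K = K'"
    by (intro finite_has_maximal)
  then obtain K where K: "K \<in> ?A" and maximal: "\<forall>K' \<in> ?A. K \<subseteq> K' \<longrightarrow> K = K'"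
    by (rule bexE)
  from K obtain g0 n0 where g0: "killed K g0 n0" by auto
  \<comment> \<open>A further error on the cone would spread to a smaller cone and enlarge the
    maximal \<open>K\<close>.\<close>
  have correct: "\<not> wrong e g"
    if g: "g \<in> DNR 3" "\<forall>m<n0. g m = g0 m" and e: "e \<in> {..<b} - K" for g e
  proof
    assume "wrong e g"
    then obtain x y where xy: "evals g e x y" "\<not> (y < 2 \<and> partial_computable x x \<noteq> Some y)"
      unfolding wrong_def by blast
    from evals_finite_use[OF xy(1)] obtain n
      where n: "\<And>h. \<forall>m<n. h m = g m \<Longrightarrow> evals h e x y" by blast
    have "wrong e h" if "\<forall>m < max n0 n. h m = g m" for h
      using n[of h] that xy(2) unfolding wrong_def by auto
    moreover have "\<forall>e \<in> K. wrong e h" if "h \<in> DNR 3" "\<forall>m < max n0 n. h m = g m" for h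
      using g0 that g(2) unfolding killed_def by (metis max_less_iff_conj max.strict_coboundedI1)
    ultimately have "killed (insert e K) g (max n0 n)"
      using g(1) unfolding killed_def by (metis insertE)
    then have "insert e K \<in> ?A" using e K by auto
    with maximal have "K = insert e K" by (meson subset_insertI)
    then show False using e by auto
  qed
  show False
  proof (rule no_uniform_solution_on_cone[of "{..<b} - K" g0 n0])
    show "g0 \<in> DNR 3" using g0 by (simp add: killed_def)
    show "\<exists>j \<in> {..<b} - K. \<exists>y. evals g j x y"
      if g: "g \<in> DNR 3" "\<forall>m<n0. g m = g0 m" for g x
    proof -
      obtain e f where ef: "e < b" "f \<in> DNR 2" "functional e g = Some f"
        using sol[OF g(1)] by (elim exE conjE bexE)
      \<comment> \<open>An index that solves \<open>g\<close> does not err on it, whereas those in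
        \<open>K\<close> do.\<close>
      have "\<not> wrong e g" unfolding wrong_def using DNR_2_evals[OF ef(3,2)] by blast
      then have "e \<notin> K" using g0 g unfolding killed_def by blast
      moreover have "evals g e x (f x)" by (rule functional_eq_SomeD[OF ef(3)])
      ultimately show ?thesis using ef(1) by auto
    qed
  qed (use correct in \<open>auto simp: wrong_def\<close>)
qed

text \<open>
  Otherwise every cone would contain another mind change, and a path with infinitely many
  mind changes could be built.
\<close>

lemma learner_constant_on_cone:
  fixes \<Psi> :: "nat list \<Rightarrow> nat"
  assumes "\<And>g. g \<in> DNR k \<Longrightarrow> convergent (\<lambda>n. \<Psi> (initial_segment g n))" "g1 \<in> DNR k"
  obtains g0 n0 where "g0 \<in> DNR k"
    "\<forall>g n. g \<in> DNR k \<longrightarrow> (\<forall>m<n0. g m = g0 m) \<longrightarrow> n0 \<le> n \<longrightarrow>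
      \<Psi> (initial_segment g n) = \<Psi> (initial_segment g0 n0)"
proof (rule ccontr)
  note cone = that
  assume none: "\<not> thesis"
  have *: "\<exists>h l. h \<in> DNR k \<and> (\<forall>m<n. h m = g m) \<and> n \<le> l \<and>
      \<Psi> (initial_segment h l) \<noteq> \<Psi> (initial_segment g n)" if "g \<in> DNR k" for g n
    using that none cone[of g n] by blast
  have seg: "initial_segment h n = initial_segment g n" if "\<forall>m<n. h m = g m" for h g :: baire and n
    using that by (simp add: initial_segment_def)
  \<comment> \<open>A mind change between lengths \<open>n - 1\<close> and \<open>n\<close>; length
    0 counts as one so that the path can start there.\<close>
  define P where "P g n \<longleftrightarrow> n = 0 \<or> \<Psi> (initial_segment g n) \<noteq> \<Psi> (initial_segment g (n - 1))"
    for g n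
  have "\<exists>g \<in> DNR k. (\<forall>m<0. g m = g1 m) \<and> (\<forall>m. \<exists>n\<ge>m. P g n)"
  proof (rule DNR_path[OF assms(2)])
    show "P g1 0" by (simp add: P_def)
    show "P h n" if "\<forall>m<n. h m = g m" "P g n" for g h n
      using that seg[of n h g] seg[of "n - 1" h g] by (auto simp: P_def)
    show "\<exists>h \<in> DNR k. \<exists>l>n. (\<forall>m<n. h m = g m) \<and> P h l" if "g \<in> DNR k" for g n
    proof -
      obtain h l where h: "h \<in> DNR k" "\<forall>m<n. h m = g m" "n \<le> l"
        "\<Psi> (initial_segment h l) \<noteq> \<Psi> (initial_segment g n)"
        using *[OF \<open>g \<in> DNR k\<close>, of n] by blast
      \<comment> \<open>At length \<open>n\<close> the guesses on \<open>h\<close> and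
        \<open>g\<close> agree, so the different guess at \<open>l\<close> requires a change after
        \<open>n\<close>.\<close>
      have "\<exists>i>n. P h i"
      proof (rule ccontr)
        assume none: "\<nexists>i. n < i \<and> P h i"
        from h(3) have "\<Psi> (initial_segment h l) = \<Psi> (initial_segment h n)"
        proof (induction l rule: dec_induct)
          case (step i)
          then show ?case using none[simplified, rule_format, of "Suc i"] by (simp add: P_def)
        qed simp
        then show False using h(4) seg[OF h(2)] by simp
      qed
      then show ?thesis using h by blast
    qed
  qed
  then obtain g where g: "g \<in> DNR k" "\<And>m. \<exists>n\<ge>m. P g n" by blast
  obtain L where "(\<lambda>n. \<Psi> (initial_segment g n)) \<longlonglongrightarrow> L"
    using assms(1)[OF g(1)] unfolding convergent_def by blast
  then have "\<forall>\<^sub>F n in sequentially. \<Psi> (initial_segment g n) = L"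
    by (simp add: tendsto_discrete)
  then obtain k where k: "\<forall>n\<ge>k. \<Psi> (initial_segment g n) = L"
    unfolding eventually_sequentially by (rule exE)
  \<comment> \<open>\<open>Suc k\<close> ensures that the guess at \<open>n - 1\<close> has settled
    too.\<close>
  obtain n where n: "n \<ge> Suc k" "P g n" using g(2)[of "Suc k"] by (elim exE conjE)
  then have "k \<le> n" "k \<le> n - 1" "n \<noteq> 0" by auto
  with k n(2) show False by (simp add: P_def)
qed

lemma not_one_omega_reducible: "\<not> reducible one_omega_computable (DNR 2) (DNR 3)"
proof
  assume "reducible one_omega_computable (DNR 2) (DNR 3)"
  then obtain \<Gamma> \<Psi> where \<Gamma>: "\<And>g. g \<in> DNR 3 \<Longrightarrow> g \<in> dom \<Gamma> \<and> the (\<Gamma> g) \<in> DNR 2"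
    and \<Psi>: "\<And>g. g \<in> dom \<Gamma> \<Longrightarrow> convergent (\<lambda>n. \<Psi> (initial_segment g n)) \<and>
      functional (lim (\<lambda>n. \<Psi> (initial_segment g n))) g = \<Gamma> g"
    unfolding reducible_def one_omega_computable_def by blast
  have "convergent (\<lambda>n. \<Psi> (initial_segment g n))" if "g \<in> DNR 3" for g
    using \<Gamma>[OF that] \<Psi>[of g] by simp
  then obtain g0 n0 where g0: "g0 \<in> DNR 3"
    "\<forall>g n. g \<in> DNR 3 \<longrightarrow> (\<forall>m<n0. g m = g0 m) \<longrightarrow> n0 \<le> n \<longrightarrow>
      \<Psi> (initial_segment g n) = \<Psi> (initial_segment g0 n0)"
    by (rule learner_constant_on_cone[OF _ DNR_3_nonempty])
  \<comment> \<open>The limit of the guesses on the whole cone, so that one functional solves all of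
    it.\<close>
  define e where "e = \<Psi> (initial_segment g0 n0)"
  have sol: "\<exists>f \<in> DNR 2. functional e g = Some f" if "g \<in> DNR 3" "\<forall>m<n0. g m = g0 m" for g
  proof -
    have "\<forall>\<^sub>F n in sequentially. \<Psi> (initial_segment g n) = e"
      using g0(2) that unfolding e_def eventually_sequentially by blast
    then have "lim (\<lambda>n. \<Psi> (initial_segment g n)) = e"
      by (intro limI tendsto_eventually)
    then show ?thesis using \<Gamma>[OF that(1)] \<Psi>[of g] by (metis domD option.sel)
  qed
  show False
  proof (rule no_uniform_solution_on_cone[of "{e}" g0 n0])
    show "\<exists>j \<in> {e}. \<exists>y. evals g j x y" if "g \<in> DNR 3" "\<forall>m<n0. g m = g0 m" for g x
      using sol[OF that] functional_eq_SomeD by blast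
    show "y < 2 \<and> partial_computable x x \<noteq> Some y"
      if "g \<in> DNR 3" "\<forall>m<n0. g m = g0 m" "j \<in> {e}" "evals g j x y" for g j x y
      using sol[OF that(1,2)] DNR_2_evals that(3,4) by blast
  qed (use g0 in simp_all)
qed

section \<open>Solving \<open>DNR 3\<close> from \<open>DNR 2\<close> by the identity\<close>

lemma functional_Oracle: "functional (goedel Oracle) g = Some g"
proof -
  have "compute (goedel Oracle) g x = Some (g x)" for x
    unfolding compute_eq_Some_iff inv_f_f[OF inj_goedel] by (rule eval.Oracle)
  then show ?thesis by (simp add: functional_def)
qed

lemma DNR_mono: "j \<le> k \<Longrightarrow> DNR j \<subseteq> DNR k"
  unfolding DNR_def using order_less_le_trans by blast

lemma learner_const: "learner (\<lambda>_. n)"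
proof -
  obtain p where p: "\<And>g x. eval g p x n"
    using computable_const[of n] unfolding computable_def by blast
  have "partial_computable (goedel p) x = Some n" for x
    unfolding partial_computable_def compute_eq_Some_iff inv_f_f[OF inj_goedel] by (rule p)
  then show ?thesis unfolding learner_def by blast
qed

theorem corollary70:
  "strictly_reducible finite_one_computable (DNR 3) (DNR 2) \<and>
   strictly_reducible one_omega_computable (DNR 3) (DNR 2)"
proof -
  \<comment> \<open>\<open>Some\<close> is the identity functional, computed by the program that
    reads the oracle; a constant learner names that program.\<close>
  have "finite_one_computable Some"
    unfolding finite_one_computable_def using functional_Oracle by blast
  moreover have "one_omega_computable Some"
    unfolding one_omega_computable_def
    by (intro exI[of _ "\<lambda>_. goedel Oracle"] conjI learner_const ballI convergent_const)
      (simp only: lim_const functional_Oracle)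
  moreover have "reducible C (DNR 3) (DNR 2)" if "C Some" for C
    unfolding reducible_def using that DNR_mono[of 2 3] by (intro exI[of _ Some]) auto
  ultimately show ?thesis
    unfolding strictly_reducible_def
    using not_finite_one_reducible not_one_omega_reducible by blast
qed

end
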